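(* Let $(X,\phi)$ be an algebraic convex geometry and let $L=\operatorname{Cld}(X,\phi)$ be its lattice of closed sets, ordered by inclusion. Let $\mathcal{C}$ be a maximal chain in $L$, and let $\mathcal{C}^*=\{D\in\mathcal{C} : D_*\prec D \text{ for some } D_*\in\mathcal{C}\}$. Define a mapping $h_{\mathcal{C}}:X\to\mathcal{C}$ by $$h_{\mathcal{C}}(x)=\bigcap\{C'\in\mathcal{C} : x\in C'\},\qquad x\in X.$$ Then $h_{\mathcal{C}}$ is a one-to-one mapping of $X$ onto $\mathcal{C}^*$.
   Context: A closure operator on a set $X$ is a map $\phi:\operatorname{Pow}X\to\operatorname{Pow}X$ (where $\operatorname{Pow}X$ is the set of all subsets of $X$) such that $A\subseteq\phi(A)$, $A\subseteq B$ implies $\phi(A)\subseteq\phi(B)$, and $\phi(\phi(A))=\phi(A)$ for all $A,B\subseteq X$. It is algebraic if moreover $\phi(A)=\bigcup\{\phi(B): B\subseteq A,\ B\text{ finite}\}$ for all $A\subseteq X$. A set $A\subseteq X$ is closed if $\phi(A)=A$; $\operatorname{Cld}(X,\phi)$ denotes the family of all closed sets, ordered by inclusion. The pair $(X,\phi)$ is a convex geometry if $\phi$ is a closure operator on $X$ with $\phi(\emptyset)=\emptyset$ satisfying the anti-exchange property: for all $x\neq y$ in $X$ and all closed $A\subseteq X$, if $x\in\phi(A\cup\{y\})$ and $x\notin A$, then $y\notin\phi(A\cup\{x\})$. It is an algebraic convex geometry if in addition $\phi$ is algebraic. $D_*\prec D$ means that $D$ covers $D_*$ in $L$: $D_*\subsetneq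 D$ and there is no closed set strictly between $D_*$ and $D$. *)

theory Defs
  imports Main
begin

text \<open>
  The ground set is an explicit carrier \<open>X\<close>, and \<open>\<phi>\<close> is constrained only on subsets of \<open>X\<close>;
  its values elsewhere are irrelevant.
\<close>

definition closure_operator_on :: "'a set \<Rightarrow> ('a set \<Rightarrow> 'a set) \<Rightarrow> bool" where
  "closure_operator_on X \<phi> \<longleftrightarrow>
     (\<forall>A. A \<subseteq> X \<longrightarrow> \<phi> A \<subseteq> X) \<and>
     (\<forall>A. A \<subseteq> X \<longrightarrow> A \<subseteq> \<phi> A) \<and>
     (\<forall>A B. A \<subseteq> X \<longrightarrow> B \<subseteq> X \<longrightarrow> A \<subseteq> B \<longrightarrow> \<phi> A \<subseteq> \<phi> B) \<and>
     (\<forall>A. A \<subseteq> X \<longrightarrow> \<phi> (\<phi> A) = \<phi> A)"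

definition algebraic_on :: "'a set \<Rightarrow> ('a set \<Rightarrow> 'a set) \<Rightarrow> bool" where
  "algebraic_on X \<phi> \<longleftrightarrow> (\<forall>A. A \<subseteq> X \<longrightarrow> \<phi> A = \<Union>{\<phi> B |B. B \<subseteq> A \<and> finite B})"

definition Cld :: "'a set \<Rightarrow> ('a set \<Rightarrow> 'a set) \<Rightarrow> 'a set set" where
  "Cld X \<phi> = {A. A \<subseteq> X \<and> \<phi> A = A}"

definition anti_exchange :: "'a set \<Rightarrow> ('a set \<Rightarrow> 'a set) \<Rightarrow> bool" where
  "anti_exchange X \<phi> \<longleftrightarrow>
     (\<forall>x\<in>X. \<forall>y\<in>X. \<forall>A\<in>Cld X \<phi>.
        x \<noteq> y \<longrightarrow> x \<in> \<phi> (A \<union> {y}) \<longrightarrow> x \<notin> A \<longrightarrow> y \<notin> \<phi> (A \<union> {x}))"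

definition convex_geometry :: "'a set \<Rightarrow> ('a set \<Rightarrow> 'a set) \<Rightarrow> bool" where
  "convex_geometry X \<phi> \<longleftrightarrow> closure_operator_on X \<phi> \<and> \<phi> {} = {} \<and> anti_exchange X \<phi>"

definition algebraic_convex_geometry :: "'a set \<Rightarrow> ('a set \<Rightarrow> 'a set) \<Rightarrow> bool" where
  "algebraic_convex_geometry X \<phi> \<longleftrightarrow> convex_geometry X \<phi> \<and> algebraic_on X \<phi>"

text \<open>\<open>covered_by L E D\<close>: in the family \<open>L\<close> ordered by inclusion, \<open>D\<close> covers \<open>E\<close>.\<close>

definition covered_by :: "'a set set \<Rightarrow> 'a set \<Rightarrow> 'a set \<Rightarrow> bool" where
  "covered_by L E D \<longleftrightarrow> E \<in> L \<and> D \<in> L \<and> E \<subset> D \<and> \<not> (\<exists>F\<in>L. E \<subset> F \<and> F \<subset> D)"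

definition upper_covers :: "'a set set \<Rightarrow> 'a set set \<Rightarrow> 'a set set" where
  "upper_covers L \<C> = {D \<in> \<C>. \<exists>E\<in>\<C>. covered_by L E D}"

text \<open>
  For a maximal chain \<open>\<C>\<close> of closed sets and \<open>x \<in> X\<close> the intersected family contains \<open>X\<close>,
  so the convention \<open>\<Inter>{} = UNIV\<close> plays no role.
\<close>

definition chain_map :: "'a set set \<Rightarrow> 'a \<Rightarrow> 'a set" where
  "chain_map \<C> x = \<Inter>{C' \<in> \<C>. x \<in> C'}"

end

theory Submission
  imports Defs
begin

text \<open>
  A maximal chain \<open>\<C>\<close> of closed sets contains every closed set that is comparable to all of its
  members (\<open>maxchain_absorbs\<close>). Hence it contains the intersections of its nonempty subfamilies,
  which are closed for any closure operator, and the unions of its subfamilies, which are closed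
  because \<open>\<phi>\<close> is algebraic and \<open>\<phi> {} = {}\<close>. Thus each point \<open>x\<close> cuts \<open>\<C>\<close> into the members that miss
  \<open>x\<close>, which have a largest element \<open>E\<close>, and the members that contain \<open>x\<close>, which have the smallest
  element \<open>chain_map \<C> x\<close>. Nothing in \<open>\<C>\<close> lies strictly between the two, and by maximality nothing
  in the whole lattice does, so \<open>chain_map \<C> x\<close> is an upper cover (\<open>chain_map_covers_below\<close>).

  The anti-exchange property enters only through \<open>cover_adds_one_point\<close>: if \<open>D\<close> covers \<open>E\<close>, then
  \<open>D - E\<close> is a singleton, because any two of its points would lie in the closure of \<open>E\<close> with the
  other one added. If two points have the same image \<open>D\<close>, both of them lie outside the lower
  neighbour of \<open>D\<close>, so they are equal. Conversely, if \<open>D\<close> covers \<open>E\<close> within \<open>\<C>\<close>, then every point of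
  \<open>D - E\<close> is mapped to \<open>D\<close>.
\<close>

section \<open>Closed sets\<close>

lemma closure_in_Cld: "closure_operator_on X \<phi> \<Longrightarrow> A \<subseteq> X \<Longrightarrow> \<phi> A \<in> Cld X \<phi>"
  by (simp add: closure_operator_on_def Cld_def)

lemma subset_closure: "closure_operator_on X \<phi> \<Longrightarrow> A \<subseteq> X \<Longrightarrow> A \<subseteq> \<phi> A"
  by (simp add: closure_operator_on_def)

lemma Cld_subset_carrier: "C \<in> Cld X \<phi> \<Longrightarrow> C \<subseteq> X"
  by (simp add: Cld_def)

lemma closure_least:
  assumes cl: "closure_operator_on X \<phi>" and C: "C \<in> Cld X \<phi>" and "A \<subseteq> C"
  shows "\<phi> A \<subseteq> C"
proof -
  have "C \<subseteq> X" "\<phi> C = C"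
    using C by (simp_all add: Cld_def)
  moreover have "A \<subseteq> X"
    using \<open>A \<subseteq> C\<close> \<open>C \<subseteq> X\<close> by (rule subset_trans)
  ultimately show ?thesis
    using cl \<open>A \<subseteq> C\<close> unfolding closure_operator_on_def by metis
qed

lemma CldI:
  assumes "closure_operator_on X \<phi>" "A \<subseteq> X" "\<phi> A \<subseteq> A"
  shows "A \<in> Cld X \<phi>"
  using assms subset_closure[OF assms(1,2)] by (simp add: Cld_def subset_antisym)

lemma Cld_Inter:
  assumes cl: "closure_operator_on X \<phi>" and S: "S \<subseteq> Cld X \<phi>" "S \<noteq> {}"
  shows "\<Inter>S \<in> Cld X \<phi>"
proof (rule CldI[OF cl])
  show "\<Inter>S \<subseteq> X"
    using S Cld_subset_carrier by blast
  show "\<phi> (\<Inter>S) \<subseteq> \<Inter>S"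
  proof (rule Inter_greatest)
    fix C assume "C \<in> S"
    then show "\<phi> (\<Inter>S) \<subseteq> C"
      using S by (intro closure_least[OF cl]) auto
  qed
qed

text \<open>
  A point of \<open>\<phi> (\<Union>S)\<close> already lies in the closure of a finite subset of \<open>\<Union>S\<close>, and in a nonempty
  chain such a finite set fits into a single closed member.
\<close>

lemma Cld_Union_chain:
  assumes geo: "algebraic_convex_geometry X \<phi>" and S: "subset.chain (Cld X \<phi>) S"
  shows "\<Union>S \<in> Cld X \<phi>"
proof -
  have cl: "closure_operator_on X \<phi>" and empty: "\<phi> {} = {}" and alg: "algebraic_on X \<phi>"
    using geo by (simp_all add: algebraic_convex_geometry_def convex_geometry_def)
  have closed: "S \<subseteq> Cld X \<phi>"
    using S by (simp add: subset_chain_def)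
  then have sub: "\<Union>S \<subseteq> X"
    using Cld_subset_carrier by blast
  have "\<phi> (\<Union>S) \<subseteq> \<Union>S"
  proof
    fix x assume x: "x \<in> \<phi> (\<Union>S)"
    have "\<phi> (\<Union>S) = \<Union>{\<phi> B |B. B \<subseteq> \<Union>S \<and> finite B}"
      using alg sub by (simp add: algebraic_on_def)
    with x obtain B where B: "x \<in> \<phi> B" "B \<subseteq> \<Union>S" "finite B"
      by auto
    have "S \<noteq> {}"
      using B empty by auto
    then obtain C where C: "C \<in> S" "B \<subseteq> C"
      using finite_subset_Union_chain[OF B(3,2) _ S] by metis
    then have "\<phi> B \<subseteq> C"
      using closed by (intro closure_least[OF cl]) auto
    then show "x \<in> \<Union>S"
      using B C by auto
  qed
  then show ?thesis
    by (rule CldI[OF cl sub])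
qed

section \<open>Completeness of maximal chains\<close>

lemma maxchain_absorbs:
  assumes max: "subset.maxchain L \<C>" and "F \<in> L" and comp: "\<And>C. C \<in> \<C> \<Longrightarrow> C \<subseteq> F \<or> F \<subseteq> C"
  shows "F \<in> \<C>"
proof (rule ccontr)
  assume "F \<notin> \<C>"
  have "subset.chain L \<C>"
    using max by (rule subset.maxchain_imp_chain)
  then have "subset.chain L (insert F \<C>)"
    using \<open>F \<in> L\<close> comp unfolding subset_chain_def by blast
  then show False
    using max \<open>F \<notin> \<C>\<close> unfolding subset.maxchain_def by blast
qed

lemma maxchain_Inter:
  assumes "closure_operator_on X \<phi>" and max: "subset.maxchain (Cld X \<phi>) \<C>"
    and "S \<subseteq> \<C>" "S \<noteq> {}"
  shows "\<Inter>S \<in> \<C>"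
proof -
  have chain: "subset.chain (Cld X \<phi>) \<C>"
    using max by (rule subset.maxchain_imp_chain)
  show ?thesis
  proof (rule maxchain_absorbs[OF max])
    show "\<Inter>S \<in> Cld X \<phi>"
      using assms(1) _ \<open>S \<noteq> {}\<close>
    proof (rule Cld_Inter)
      show "S \<subseteq> Cld X \<phi>"
        using \<open>S \<subseteq> \<C>\<close> chain by (auto simp: subset_chain_def)
    qed
    show "C \<subseteq> \<Inter>S \<or> \<Inter>S \<subseteq> C" if "C \<in> \<C>" for C
    proof (cases "\<exists>B\<in>S. B \<subseteq> C")
      case True
      then obtain B where "B \<in> S" "B \<subseteq> C"
        by auto
      then show ?thesis
        using Inter_lower[of B S] by auto
    next
      case False
      have "C \<subseteq> \<Inter>S"
      proof (rule Inter_greatest)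
        fix B assume "B \<in> S"
        moreover from this have "B \<in> \<C>"
          using \<open>S \<subseteq> \<C>\<close> by auto
        ultimately show "C \<subseteq> B"
          using False \<open>C \<in> \<C>\<close> chain unfolding subset_chain_def by metis
      qed
      then show ?thesis ..
    qed
  qed
qed

lemma maxchain_Union:
  assumes "algebraic_convex_geometry X \<phi>" and max: "subset.maxchain (Cld X \<phi>) \<C>"
    and "S \<subseteq> \<C>"
  shows "\<Union>S \<in> \<C>"
proof -
  have chain: "subset.chain (Cld X \<phi>) \<C>"
    using max by (rule subset.maxchain_imp_chain)
  show ?thesis
  proof (rule maxchain_absorbs[OF max])
    have "subset.chain (Cld X \<phi>) S"
      using chain \<open>S \<subseteq> \<C>\<close> unfolding subset_chain_def by blast
    then show "\<Union>S \<in> Cld X \<phi>"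
      by (rule Cld_Union_chain[OF assms(1)])
    show "C \<subseteq> \<Union>S \<or> \<Union>S \<subseteq> C" if "C \<in> \<C>" for C
      using that chain \<open>S \<subseteq> \<C>\<close> unfolding subset_chain_def by blast
  qed
qed

lemma carrier_in_maxchain:
  assumes "closure_operator_on X \<phi>" and max: "subset.maxchain (Cld X \<phi>) \<C>"
  shows "X \<in> \<C>"
proof (rule maxchain_absorbs[OF max])
  show "X \<in> Cld X \<phi>"
    using assms(1) by (intro CldI) (simp_all add: closure_operator_on_def)
  show "C \<subseteq> X \<or> X \<subseteq> C" if "C \<in> \<C>" for C
    using that subset.maxchain_imp_chain[OF max] Cld_subset_carrier
    unfolding subset_chain_def by blast
qed

section \<open>Covers and the chain map\<close>

text \<open>
  Adding any point of \<open>D - E\<close> to \<open>E\<close> generates all of \<open>D\<close>, since no closed set lies strictly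
  between; for two different points this contradicts anti-exchange over \<open>E\<close>.
\<close>

lemma cover_adds_one_point:
  assumes geo: "convex_geometry X \<phi>" and cov: "covered_by (Cld X \<phi>) E D"
    and x: "x \<in> D - E" and y: "y \<in> D - E"
  shows "x = y"
proof (rule ccontr)
  assume "x \<noteq> y"
  have cl: "closure_operator_on X \<phi>" and ae: "anti_exchange X \<phi>"
    using geo unfolding convex_geometry_def by auto
  have E: "E \<in> Cld X \<phi>" "E \<subseteq> D" and D: "D \<in> Cld X \<phi>"
    using cov by (auto simp: covered_by_def)
  have "D \<subseteq> X"
    using D by (rule Cld_subset_carrier)
  have generates: "\<phi> (E \<union> {z}) = D" if z: "z \<in> D - E" for z
  proof -
    have sub: "E \<union> {z} \<subseteq> D" "E \<union> {z} \<subseteq> X"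
      using z E \<open>D \<subseteq> X\<close> by auto
    have "\<phi> (E \<union> {z}) \<subseteq> D"
      using cl D sub(1) by (rule closure_least)
    moreover have "E \<subset> \<phi> (E \<union> {z})"
      using subset_closure[OF cl sub(2)] z by blast
    moreover have "\<phi> (E \<union> {z}) \<in> Cld X \<phi>"
      using cl sub(2) by (rule closure_in_Cld)
    ultimately show ?thesis
      using cov by (auto simp: covered_by_def)
  qed
  have "x \<in> \<phi> (E \<union> {y})" "y \<in> \<phi> (E \<union> {x})"
    using generates x y by auto
  then show False
    using ae E(1) \<open>D \<subseteq> X\<close> x y \<open>x \<noteq> y\<close> unfolding anti_exchange_def by blast
qed

text \<open>
  The lower neighbour of \<open>chain_map \<C> x\<close> is the union of the members of \<open>\<C>\<close> that miss \<open>x\<close>.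
\<close>

lemma chain_map_covers_below:
  assumes geo: "algebraic_convex_geometry X \<phi>" and max: "subset.maxchain (Cld X \<phi>) \<C>"
    and "x \<in> X"
  obtains E where "E \<in> \<C>" "chain_map \<C> x \<in> \<C>" "covered_by (Cld X \<phi>) E (chain_map \<C> x)"
proof -
  define D where "D = chain_map \<C> x"
  define E where "E = \<Union>{C \<in> \<C>. x \<notin> C}"
  have cl: "closure_operator_on X \<phi>"
    using geo unfolding algebraic_convex_geometry_def convex_geometry_def by blast
  have chain: "\<C> \<subseteq> Cld X \<phi>" "\<And>A B. A \<in> \<C> \<Longrightarrow> B \<in> \<C> \<Longrightarrow> A \<subseteq> B \<or> B \<subseteq> A"
    using subset.maxchain_imp_chain[OF max] unfolding subset_chain_def by auto
  have "{C \<in> \<C>. x \<in> C} \<noteq> {}"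
    using carrier_in_maxchain[OF cl max] \<open>x \<in> X\<close> by blast
  then have D: "D \<in> \<C>"
    unfolding D_def chain_map_def by (intro maxchain_Inter[OF cl max]) auto
  have E: "E \<in> \<C>"
    unfolding E_def by (rule maxchain_Union[OF geo max]) blast
  have "x \<in> D" "x \<notin> E"
    unfolding D_def chain_map_def E_def by auto
  then have "E \<subset> D"
    using chain(2)[OF D E] by blast
  have split: "C \<subseteq> E \<or> D \<subseteq> C" if "C \<in> \<C>" for C
    using that unfolding D_def chain_map_def E_def by blast
  have "\<not> (E \<subset> F \<and> F \<subset> D)" if F: "F \<in> Cld X \<phi>" for F
  proof
    assume between: "E \<subset> F \<and> F \<subset> D"
    \<comment> \<open>Every member of \<open>\<C>\<close> is below \<open>E\<close> or above \<open>D\<close>, so \<open>F\<close> is comparable to all of them.\<close>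
    have "F \<in> \<C>"
      using split between by (intro maxchain_absorbs[OF max F]) blast
    then show False
      using split between by blast
  qed
  then have "covered_by (Cld X \<phi>) E D"
    using D E chain \<open>E \<subset> D\<close> unfolding covered_by_def by blast
  then show ?thesis
    using that D E unfolding D_def by blast
qed

lemma chain_map_eq_cover:
  assumes chain: "subset.chain L \<C>" and "D \<in> \<C>" "E \<in> \<C>" and cov: "covered_by L E D"
    and x: "x \<in> D - E"
  shows "chain_map \<C> x = D"
proof -
  have "D \<subseteq> C" if C: "C \<in> \<C>" "x \<in> C" for C
  proof -
    have "E \<subset> C"
      using chain C x \<open>E \<in> \<C>\<close> unfolding subset_chain_def by blast
    then have "\<not> C \<subset> D"
      using chain C cov unfolding covered_by_def subset_chain_def by blast
    then show ?thesis
      using chain C \<open>D \<in> \<C>\<close> unfolding subset_chain_def by blast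
  qed
  then show ?thesis
    using x \<open>D \<in> \<C>\<close> unfolding chain_map_def by blast
qed

theorem lemma17:
  fixes X :: "'a set" and \<phi> :: "'a set \<Rightarrow> 'a set" and \<C> :: "'a set set"
  assumes "algebraic_convex_geometry X \<phi>"
    and "subset.maxchain (Cld X \<phi>) \<C>"
  shows "bij_betw (chain_map \<C>) X (upper_covers (Cld X \<phi>) \<C>)"
proof -
  have geo: "convex_geometry X \<phi>"
    using assms(1) unfolding algebraic_convex_geometry_def by blast
  have chain: "subset.chain (Cld X \<phi>) \<C>"
    using assms(2) by (rule subset.maxchain_imp_chain)
  have "inj_on (chain_map \<C>) X"
  proof (rule inj_onI)
    fix x y assume "x \<in> X" "y \<in> X" and eq: "chain_map \<C> x = chain_map \<C> y"
    obtain E where E: "E \<in> \<C>" "covered_by (Cld X \<phi>) E (chain_map \<C> x)"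
      using chain_map_covers_below[OF assms \<open>x \<in> X\<close>] .
    \<comment> \<open>A point with image \<open>D\<close> lies in no member of \<open>\<C>\<close> that is properly below \<open>D\<close>.\<close>
    have outside: "z \<in> chain_map \<C> x - E" if "chain_map \<C> z = chain_map \<C> x" for z
    proof -
      have "z \<in> chain_map \<C> z"
        unfolding chain_map_def by blast
      moreover have "chain_map \<C> z \<subseteq> E" if "z \<in> E"
        using that E(1) unfolding chain_map_def by blast
      ultimately show ?thesis
        using that E(2) unfolding covered_by_def by auto
    qed
    show "x = y"
      using cover_adds_one_point[OF geo E(2)] outside eq by metis
  qed
  moreover have "chain_map \<C> ` X = upper_covers (Cld X \<phi>) \<C>"
  proof
    show "chain_map \<C> ` X \<subseteq> upper_covers (Cld X \<phi>) \<C>"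
    proof
      fix D assume "D \<in> chain_map \<C> ` X"
      then obtain x where "x \<in> X" and D: "D = chain_map \<C> x"
        by blast
      then show "D \<in> upper_covers (Cld X \<phi>) \<C>"
        using chain_map_covers_below[OF assms \<open>x \<in> X\<close>] unfolding upper_covers_def D by blast
    qed
    show "upper_covers (Cld X \<phi>) \<C> \<subseteq> chain_map \<C> ` X"
    proof
      fix D assume "D \<in> upper_covers (Cld X \<phi>) \<C>"
      then obtain E where D: "D \<in> \<C>" and E: "E \<in> \<C>" and cov: "covered_by (Cld X \<phi>) E D"
        unfolding upper_covers_def by blast
      then obtain x where x: "x \<in> D - E"
        unfolding covered_by_def by blast
      then have "x \<in> X"
        using cov unfolding covered_by_def Cld_def by blast
      then show "D \<in> chain_map \<C> ` X"
        using chain_map_eq_cover[OF chain D E cov x] by blast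
    qed
  qed
  ultimately show ?thesis
    unfolding bij_betw_def by blast
qed

end
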